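(* Let $1\le N<M$ be integers and let $H_0$ be a fixed self-adjoint operator on $\mathcal{H}_N=\Lambda^N\mathbb{C}^M$. Let $\mathcal{U}_{M,N}\subseteq\mathcal{P}_{M,N}$ be the set of uniquely $v$-representable densities that come from non-degenerate ground states. Then $\mathcal{U}_{M,N}$ is open, i.e. for every $\rho\in\mathcal{U}_{M,N}$ there is an $\varepsilon>0$ such that every $\rho'\in\mathcal{P}_{M,N}$ with $\|\rho'-\rho\|<\varepsilon$ belongs to $\mathcal{U}_{M,N}$.
   Context: Setting: $X=\{1,\dots,M\}$, $e_1,\dots,e_M$ the standard basis of $\mathbb{C}^M$. $\mathcal{H}_N=\Lambda^N\mathbb{C}^M$ is the $N$-fold antisymmetric tensor product, with orthonormal basis $e_I=e_{i_1}\wedge\dots\wedge e_{i_N}$ indexed by ordered multi-indices $I=(i_1<\dots<i_N)$ in $X$. $\hat a_i^\dagger,\hat a_i$ are the fermionic creation/annihilation operators for $e_i$, so $\hat a_i^\dagger\hat a_i e_I=e_I$ if $i\in I$ and $0$ otherwise. A potential $v\in\mathbb{R}^M$ acts on $\mathcal{H}_N$ as $V=\sum_i v_i\hat a_i^\dagger\hat a_i$, and $H(v)=H_0+V$. The density of a normalized $\Psi=\sum_I\Psi_Ie_I$ is $\rho_i=\sum_{I\ni i}|\Psi_I|^2$. Physical densities: $\mathcal{P}_{M,N}=\{\rho\in\mathbb{R}^M\mid 0\le\rho_i\le1,\ \sum_i\rho_i=N\}$. A ground state $\Psi$ of $H(v)$, and its density $\rho$, are called uniquely $v$-representable (uv)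 if there is no $v'\in\mathbb{R}^M$ with $v-v'$ not a constant vector such that $\Psi$ is also a ground state of $H(v')$. Thus $\rho\in\mathcal{U}_{M,N}$ iff there is $v\in\mathbb{R}^M$ such that the smallest eigenvalue of $H(v)$ is simple, the corresponding normalized eigenvector $\Psi$ has density $\rho$, and $\Psi$ is uv. $\|\cdot\|$ is any norm on $\mathbb{R}^M$. *)

theory Defs
  imports "HOL-Analysis.Analysis"
begin

section \<open>Fermionic Fock space\<close>

text \<open>
  A finite linearly ordered type \<open>'m\<close> plays the role of \<open>X = {1 < \<dots> < M}\<close>, so
  \<open>M = CARD('m)\<close>. An ordered multi-index \<open>i\<^sub>1 < \<dots> < i\<^sub>N\<close> is the same as a set of
  cardinality \<open>N\<close>, and \<open>\<Psi> $ I\<close> is the coefficient of \<open>\<Psi>\<close> at the orthonormal basis vector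
  \<open>e\<^sub>I = e\<^sub>i\<^sub>1 \<and> \<dots> \<and> e\<^sub>i\<^sub>N\<close>. Vectors indexed by all subsets form the exterior algebra
  of \<open>\<complex>\<^sup>M\<close>; the creation and annihilation operators need it because they
  change the particle number.
\<close>

type_synonym 'm fock = "complex ^ ('m set)"

definition N_space :: "nat \<Rightarrow> ('m::finite) fock set" where
  "N_space N = {\<Psi>. \<forall>I. \<Psi> $ I \<noteq> 0 \<longrightarrow> card I = N}"

definition fock_inner :: "('m::finite) fock \<Rightarrow> 'm fock \<Rightarrow> complex" where
  "fock_inner \<Phi> \<Psi> = (\<Sum>I\<in>UNIV. cnj (\<Phi> $ I) * \<Psi> $ I)"

text \<open>
  \<open>create i\<close> is \<open>\<Psi> \<mapsto> e\<^sub>i \<and> \<Psi>\<close>. Moving \<open>e\<^sub>i\<close> to its place in an ordered wedge product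
  passes the factors with smaller index, whence the sign. \<open>annihilate i\<close> is its adjoint.
\<close>

definition fermi_sign :: "'m::{finite,linorder} \<Rightarrow> 'm set \<Rightarrow> complex" where
  "fermi_sign i I = (- 1) ^ card {j \<in> I. j < i}"

definition create :: "'m::{finite,linorder} \<Rightarrow> 'm fock \<Rightarrow> 'm fock" where
  "create i \<Psi> = (\<chi> I. if i \<in> I then fermi_sign i I * \<Psi> $ (I - {i}) else 0)"

definition annihilate :: "'m::{finite,linorder} \<Rightarrow> 'm fock \<Rightarrow> 'm fock" where
  "annihilate i \<Psi> = (\<chi> I. if i \<notin> I then fermi_sign i I * \<Psi> $ (insert i I) else 0)"

lemma fermi_sign_same [simp]:
  "fermi_sign i (I - {i}) = fermi_sign i I" "fermi_sign i (insert i I) = fermi_sign i I"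
  unfolding fermi_sign_def by (rule arg_cong[where f = "\<lambda>S. (- 1) ^ card S"]; auto)+

lemma annihilate_adjoint: "fock_inner (create i \<Phi>) \<Psi> = fock_inner \<Phi> (annihilate i \<Psi>)"
proof -
  have "fock_inner (create i \<Phi>) \<Psi> =
      (\<Sum>I | i \<in> I. fermi_sign i I * cnj (\<Phi> $ (I - {i})) * \<Psi> $ I)"
    unfolding fock_inner_def create_def fermi_sign_def
    by (rule sum.mono_neutral_cong_right) auto
  also have "\<dots> = (\<Sum>I | i \<notin> I. fermi_sign i I * cnj (\<Phi> $ I) * \<Psi> $ (insert i I))"
    by (rule sum.reindex_bij_witness[where i = "insert i" and j = "\<lambda>I. I - {i}"])
       (auto simp: insert_absorb)
  also have "\<dots> = fock_inner \<Phi> (annihilate i \<Psi>)"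
    unfolding fock_inner_def annihilate_def fermi_sign_def
    by (rule sum.mono_neutral_cong_left) auto
  finally show ?thesis .
qed

lemma create_axis:
  "create i (axis I 1) = (if i \<in> I then 0 else fermi_sign i I *s axis (insert i I) 1)"
  by (auto simp: create_def axis_def vec_eq_iff insert_absorb)

text \<open>The basis vector at \<open>I\<close> is the ordered wedge product of the \<open>e\<^sub>i\<close> with \<open>i \<in> I\<close>.\<close>

lemma wedge_sorted:
  "sorted_wrt (<) is \<Longrightarrow> foldr create is (axis {} 1) = axis (set is) 1"
proof (induction "is")
  case (Cons i "is")
  then have "{j \<in> set is. j < i} = {}" "i \<notin> set is" by auto
  then have "fermi_sign i (set is) = 1" 
    unfolding fermi_sign_def by (simp only: card.empty power_0)
  with Cons \<open>i \<notin> set is\<close> show ?case by (simp add: create_axis)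
qed simp

lemma number_operator: "create i (annihilate i \<Psi>) $ I = (if i \<in> I then \<Psi> $ I else 0)"
proof -
  have "fermi_sign i I * fermi_sign i I = 1"
    by (simp add: fermi_sign_def flip: power_add)
  then show ?thesis
    by (simp add: create_def annihilate_def insert_absorb flip: mult.assoc)
qed

section \<open>Hamiltonians and ground states\<close>

text \<open>
  An operator on \<open>N_space N\<close> is a function on the whole Fock space of which only the
  values on \<open>N_space N\<close> matter.
\<close>

definition self_adjoint_on :: "nat \<Rightarrow> (('m::finite) fock \<Rightarrow> 'm fock) \<Rightarrow> bool" where
  "self_adjoint_on N T \<longleftrightarrow>
     (\<forall>\<Psi>\<in>N_space N. T \<Psi> \<in> N_space N) \<and>
     (\<forall>\<Phi>\<in>N_space N. \<forall>\<Psi>\<in>N_space N. T (\<Phi> + \<Psi>) = T \<Phi> + T \<Psi>) \<and>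
     (\<forall>c. \<forall>\<Psi>\<in>N_space N. T (c *s \<Psi>) = c *s T \<Psi>) \<and>
     (\<forall>\<Phi>\<in>N_space N. \<forall>\<Psi>\<in>N_space N. fock_inner \<Phi> (T \<Psi>) = fock_inner (T \<Phi>) \<Psi>)"

definition potential_op :: "real ^ ('m::{finite,linorder}) \<Rightarrow> 'm fock \<Rightarrow> 'm fock" where
  "potential_op v \<Psi> = (\<Sum>i\<in>UNIV. complex_of_real (v $ i) *s create i (annihilate i \<Psi>))"

definition hamiltonian ::
  "('m fock \<Rightarrow> 'm fock) \<Rightarrow> real ^ ('m::{finite,linorder}) \<Rightarrow> 'm fock \<Rightarrow> 'm fock" where
  "hamiltonian H0 v \<Psi> = H0 \<Psi> + potential_op v \<Psi>"

text \<open>Self-adjoint operators have real eigenvalues only, so \<open>E\<close> ranges over the reals.\<close>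

definition eigenspace :: "nat \<Rightarrow> (('m::finite) fock \<Rightarrow> 'm fock) \<Rightarrow> real \<Rightarrow> 'm fock set" where
  "eigenspace N T E = {\<Psi> \<in> N_space N. T \<Psi> = complex_of_real E *s \<Psi>}"

definition is_eigenvalue :: "nat \<Rightarrow> (('m::finite) fock \<Rightarrow> 'm fock) \<Rightarrow> real \<Rightarrow> bool" where
  "is_eigenvalue N T E \<longleftrightarrow> (\<exists>\<Psi>\<in>eigenspace N T E. \<Psi> \<noteq> 0)"

definition smallest_eigenvalue :: "nat \<Rightarrow> (('m::finite) fock \<Rightarrow> 'm fock) \<Rightarrow> real \<Rightarrow> bool" where
  "smallest_eigenvalue N T E \<longleftrightarrow>
     is_eigenvalue N T E \<and> (\<forall>E'. is_eigenvalue N T E' \<longrightarrow> E \<le> E')"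

text \<open>
  The dimension is taken over \<open>\<complex>\<close>; geometric and algebraic multiplicity of an eigenvalue of a
  self-adjoint operator agree.
\<close>

definition simple_eigenvalue :: "nat \<Rightarrow> (('m::finite) fock \<Rightarrow> 'm fock) \<Rightarrow> real \<Rightarrow> bool" where
  "simple_eigenvalue N T E \<longleftrightarrow> vec.dim (eigenspace N T E) = 1"

definition ground_state :: "nat \<Rightarrow> (('m::finite) fock \<Rightarrow> 'm fock) \<Rightarrow> 'm fock \<Rightarrow> bool" where
  "ground_state N T \<Psi> \<longleftrightarrow>
     \<Psi> \<noteq> 0 \<and> (\<exists>E. smallest_eigenvalue N T E \<and> \<Psi> \<in> eigenspace N T E)"

section \<open>Densities and unique \<open>v\<close>-representability\<close>

definition density :: "'m fock \<Rightarrow> real ^ ('m::finite)" where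
  "density \<Psi> = (\<chi> i. \<Sum>I | i \<in> I. (cmod (\<Psi> $ I))\<^sup>2)"

definition physical_densities :: "nat \<Rightarrow> (real ^ ('m::finite)) set" where
  "physical_densities N =
     {\<rho>. (\<forall>i. 0 \<le> \<rho> $ i \<and> \<rho> $ i \<le> 1) \<and> (\<Sum>i\<in>UNIV. \<rho> $ i) = real N}"

definition constant_vector :: "real ^ ('m::finite) \<Rightarrow> bool" where
  "constant_vector u \<longleftrightarrow> (\<exists>c. \<forall>i. u $ i = c)"

definition uv_state ::
  "nat \<Rightarrow> ('m fock \<Rightarrow> 'm fock) \<Rightarrow> real ^ ('m::{finite,linorder}) \<Rightarrow> 'm fock \<Rightarrow> bool" where
  "uv_state N H0 v \<Psi> \<longleftrightarrow>
     ground_state N (hamiltonian H0 v) \<Psi> \<and>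
     \<not> (\<exists>v'. \<not> constant_vector (v - v') \<and> ground_state N (hamiltonian H0 v') \<Psi>)"

definition uv_densities ::
  "nat \<Rightarrow> ('m fock \<Rightarrow> 'm fock) \<Rightarrow> (real ^ ('m::{finite,linorder})) set" where
  "uv_densities N H0 = {\<rho>. \<exists>v E \<Psi>.
     smallest_eigenvalue N (hamiltonian H0 v) E \<and>
     simple_eigenvalue N (hamiltonian H0 v) E \<and>
     \<Psi> \<in> eigenspace N (hamiltonian H0 v) E \<and> norm \<Psi> = 1 \<and>
     density \<Psi> = \<rho> \<and> uv_state N H0 v \<Psi>}"

lemma density_physical:
  fixes \<Psi> :: "('m::finite) fock"
  assumes "\<Psi> \<in> N_space N" "norm \<Psi> = 1"
  shows "density \<Psi> \<in> physical_densities N"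
proof -
  have total: "(\<Sum>I\<in>UNIV. (cmod (\<Psi> $ I))\<^sup>2) = 1"
    using assms(2) by (simp add: norm_vec_def L2_set_def)
  have "density \<Psi> $ i \<le> 1" for i
    unfolding density_def total[symmetric] by (auto intro: sum_mono2)
  moreover have "0 \<le> density \<Psi> $ i" for i
    by (simp add: density_def sum_nonneg)
  moreover have "(\<Sum>i\<in>UNIV. density \<Psi> $ i) = real N"
  proof -
    have "(\<Sum>i\<in>UNIV. density \<Psi> $ i) =
        (\<Sum>i\<in>UNIV. \<Sum>I\<in>UNIV. if i \<in> I then (cmod (\<Psi> $ I))\<^sup>2 else 0)"
      by (simp add: density_def sum.If_cases)
    also have "\<dots> = (\<Sum>I\<in>UNIV. real (card I) * (cmod (\<Psi> $ I))\<^sup>2)"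
      by (subst sum.swap) (simp add: sum.If_cases)
    also have "\<dots> = (\<Sum>I\<in>UNIV. real N * (cmod (\<Psi> $ I))\<^sup>2)"
      using assms(1) by (intro sum.cong) (auto simp: N_space_def)
    finally show ?thesis using total by (simp flip: sum_distrib_left)
  qed
  ultimately show ?thesis by (simp add: physical_densities_def)
qed

lemma uv_densities_physical: "uv_densities N H0 \<subseteq> physical_densities N"
  by (auto simp: uv_densities_def eigenspace_def intro: density_physical)

text \<open>Any norm on \<open>\<real>\<^sup>M\<close>, not only the Euclidean one provided by the type class.\<close>

definition is_norm :: "('a::real_vector \<Rightarrow> real) \<Rightarrow> bool" where
  "is_norm nrm \<longleftrightarrow>
     (\<forall>x. 0 \<le> nrm x) \<and> (\<forall>x. nrm x = 0 \<longleftrightarrow> x = 0) \<and>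
     (\<forall>c x. nrm (c *\<^sub>R x) = \<bar>c\<bar> * nrm x) \<and> (\<forall>x y. nrm (x + y) \<le> nrm x + nrm y)"

end

theory Submission
  imports Defs
begin

text \<open>
  Let \<open>e(v)\<close> be the ground energy of \<open>H(v)\<close>, a minimum of functions affine in \<open>v\<close>. If \<open>\<rho>\<close> comes
  from a non-degenerate uv ground state \<open>\<Psi>\<close> at \<open>v0\<close>, then \<open>v0\<close> is the only maximum of
  \<open>e(v) - v \<bullet> \<rho>\<close> modulo constants. Hence for \<open>\<rho>'\<close> close to \<open>\<rho>\<close> the function \<open>e(v) - v \<bullet> \<rho>'\<close> has a
  local maximum \<open>v\<close> near \<open>v0\<close>. For \<open>v\<close> near \<open>v0\<close> the ground state is still non-degenerate, so \<open>e\<close> is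
  differentiable there with gradient the density, which must therefore be \<open>\<rho>'\<close>.
  It is again uv: its support contains that of \<open>\<Psi>\<close>, and a second potential \<open>v + u\<close> with the same
  ground state makes \<open>\<Sum>i\<in>I. u i\<close> constant for \<open>I\<close> in the support, whence \<open>\<Psi>\<close> would be a ground
  state of \<open>H(v0 + t u)\<close> for small \<open>t\<close>.
\<close>

section \<open>The N-particle subspace and its inner product\<close>

lemma N_space_add: "\<Phi> \<in> N_space N \<Longrightarrow> \<Psi> \<in> N_space N \<Longrightarrow> \<Phi> + \<Psi> \<in> N_space N"
  unfolding N_space_def by (auto, metis add_0)

lemma N_space_scale: "\<Psi> \<in> N_space N \<Longrightarrow> c *s \<Psi> \<in> N_space N"
  unfolding N_space_def by auto

lemma N_space_diff: "\<Phi> \<in> N_space N \<Longrightarrow> \<Psi> \<in> N_space N \<Longrightarrow> \<Phi> - \<Psi> \<in> N_space N"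
  unfolding N_space_def by auto metis

lemma closed_N_space: "closed (N_space N :: ('m::finite) fock set)"
proof -
  have "N_space N = (\<Inter>I\<in>{I. card I \<noteq> N}. {\<Psi>::'m fock. \<Psi> $ I = 0})"
    unfolding N_space_def by auto
  then show ?thesis
    by (auto intro!: closed_INT closed_Collect_eq continuous_intros)
qed

lemma of_real_smult: "complex_of_real c *s \<Psi> = c *\<^sub>R \<Psi>"
  by (simp add: vec_eq_iff) (simp add: scaleR_conv_of_real)

lemma fock_inner_add_right: "fock_inner \<Phi> (X + Y) = fock_inner \<Phi> X + fock_inner \<Phi> Y"
  by (simp add: fock_inner_def distrib_left sum.distrib)

lemma fock_inner_add_left: "fock_inner (X + Y) \<Phi> = fock_inner X \<Phi> + fock_inner Y \<Phi>"
  by (simp add: fock_inner_def distrib_right sum.distrib)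

lemma fock_inner_scale_right: "fock_inner \<Phi> (c *s X) = c * fock_inner \<Phi> X"
  by (simp add: fock_inner_def sum_distrib_left mult_ac)

lemma fock_inner_scale_left: "fock_inner (c *s X) \<Phi> = cnj c * fock_inner X \<Phi>"
  by (simp add: fock_inner_def sum_distrib_left mult_ac)

lemma fock_inner_cnj: "cnj (fock_inner X Y) = fock_inner Y X"
  by (simp add: fock_inner_def mult.commute)

lemma fock_inner_self: "fock_inner X X = complex_of_real ((norm X)\<^sup>2)"
proof -
  have "cnj z * z = complex_of_real ((cmod z)\<^sup>2)" for z
    by (simp only: complex_norm_square mult.commute)
  then show ?thesis
    by (simp add: fock_inner_def norm_vec_def L2_set_def sum_nonneg)
qed

lemma continuous_on_fock_inner [continuous_intros]:
  "continuous_on S f \<Longrightarrow> continuous_on S g \<Longrightarrow> continuous_on S (\<lambda>x. fock_inner (f x) (g x))"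
  unfolding fock_inner_def by (intro continuous_intros)

lemma self_adjoint_onD:
  assumes "self_adjoint_on N A" "X \<in> N_space N" "Y \<in> N_space N"
  shows "A X \<in> N_space N" "A (X + Y) = A X + A Y" "A (c *s X) = c *s A X"
    "fock_inner X (A Y) = fock_inner (A X) Y"
  using assms unfolding self_adjoint_on_def by blast+

text \<open>\<open>A\<close> is only controlled on \<open>N_space N\<close>. Precomposing with the
  coordinate projection \<open>P\<close> onto that subspace gives a map that is real-linear on the
  whole finite-dimensional space, hence continuous, and agrees with \<open>A\<close> on
  \<open>N_space N\<close>.\<close>

lemma continuous_on_self_adjoint:
  fixes A :: "('m::finite) fock \<Rightarrow> 'm fock"
  assumes A: "self_adjoint_on N A"
  shows "continuous_on (N_space N) A"
proof -
  define P :: "'m fock \<Rightarrow> 'm fock" where "P \<Psi> = (\<chi> I. if card I = N then \<Psi> $ I else 0)" for \<Psi>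
  have P: "P \<Psi> \<in> N_space N" for \<Psi> by (auto simp: P_def N_space_def)
  have id: "P \<Psi> = \<Psi>" if "\<Psi> \<in> N_space N" for \<Psi>
    using that by (auto simp: P_def N_space_def vec_eq_iff)
  have "linear (\<lambda>\<Psi>. A (P \<Psi>))"
  proof (rule linearI)
    fix X Y :: "'m fock" and c :: real
    have "P (X + Y) = P X + P Y" by (simp add: P_def vec_eq_iff)
    then show "A (P (X + Y)) = A (P X) + A (P Y)"
      using self_adjoint_onD(2)[OF A P P] by simp
    have "P (c *\<^sub>R X) = complex_of_real c *s P X"
      by (simp add: P_def vec_eq_iff) (simp add: scaleR_conv_of_real)
    then show "A (P (c *\<^sub>R X)) = c *\<^sub>R A (P X)"
      using self_adjoint_onD(3)[OF A P P, of "complex_of_real c" X] by (simp only: of_real_smult)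
  qed
  then have "continuous_on (N_space N) (\<lambda>\<Psi>. A (P \<Psi>))" 
    by (simp add: linear_continuous_on linear_conv_bounded_linear)
  then show ?thesis by (rule continuous_on_eq) (simp add: id)
qed

section \<open>The Rayleigh principle\<close>

definition N_sphere :: "nat \<Rightarrow> ('m::finite) fock set" where
  "N_sphere N = {\<Psi> \<in> N_space N. norm \<Psi> = 1}"

definition energy :: "(('m::finite) fock \<Rightarrow> 'm fock) \<Rightarrow> 'm fock \<Rightarrow> real" where
  "energy A \<Psi> = Re (fock_inner \<Psi> (A \<Psi>))"

text \<open>The variational form of a normalized ground state;
  \<open>ground_state_iff_minimizer\<close> proves the equivalence for self-adjoint
  \<open>A\<close>.\<close>

definition minimizer :: "nat \<Rightarrow> (('m::finite) fock \<Rightarrow> 'm fock) \<Rightarrow> 'm fock \<Rightarrow> bool" where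
  "minimizer N A \<Psi> \<longleftrightarrow> \<Psi> \<in> N_sphere N \<and> (\<forall>X\<in>N_sphere N. energy A \<Psi> \<le> energy A X)"

lemma compact_N_sphere: "compact (N_sphere N :: ('m::finite) fock set)"
proof -
  have "N_sphere N = N_space N \<inter> sphere (0 :: 'm fock) 1"
    by (auto simp: N_sphere_def)
  then show ?thesis by (simp add: closed_N_space closed_Int_compact)
qed

lemma normalized_in_N_sphere:
  assumes "X \<in> N_space N" "X \<noteq> 0"
  shows "complex_of_real (1 / norm X) *s X \<in> N_sphere N"
  using assms N_space_scale[OF assms(1), of "complex_of_real (1 / norm X)"]
  by (simp add: N_sphere_def of_real_smult del: of_real_divide)

lemma continuous_on_energy:
  assumes "self_adjoint_on N A"
  shows "continuous_on (N_sphere N) (energy A)"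
proof -
  have "continuous_on (N_sphere N) A"
    by (rule continuous_on_subset[OF continuous_on_self_adjoint[OF assms]]) (auto simp: N_sphere_def)
  then show ?thesis unfolding energy_def by (intro continuous_intros)
qed

lemma minimizer_exists:
  fixes A :: "('m::finite) fock \<Rightarrow> 'm fock"
  assumes "self_adjoint_on N A" "N_sphere N \<noteq> ({} :: 'm fock set)"
  shows "\<exists>\<Psi>. minimizer N A \<Psi>"
  using continuous_attains_inf[OF compact_N_sphere assms(2) continuous_on_energy[OF assms(1)]]
  by (auto simp: minimizer_def)

lemma energy_eigenvector:
  "X \<in> eigenspace N A E \<Longrightarrow> energy A X = E * (norm X)\<^sup>2"
  by (simp add: energy_def eigenspace_def fock_inner_scale_right fock_inner_self del: of_real_power)

lemma eigenspace_scale: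
  assumes "self_adjoint_on N A" "X \<in> eigenspace N A E"
  shows "c *s X \<in> eigenspace N A E"
  using assms self_adjoint_onD(3)[OF assms(1)] 
  by (auto simp: eigenspace_def N_space_scale vector_smult_assoc mult.commute)

lemma eigenspace_diff:
  assumes A: "self_adjoint_on N A" and X: "X \<in> eigenspace N A E" and Y: "Y \<in> eigenspace N A E"
  shows "X - Y \<in> eigenspace N A E"
proof -
  have Z: "(-1) *s Y \<in> eigenspace N A E" by (rule eigenspace_scale[OF A Y])
  have "X + (-1) *s Y \<in> eigenspace N A E"
    using X Y Z self_adjoint_onD(2)[OF A, of X "(-1) *s Y"]
    by (simp add: eigenspace_def N_space_diff vector_ssub_ldistrib)
  then show ?thesis by simp
qed

lemma energy_scale:
  assumes "self_adjoint_on N A" "X \<in> N_space N"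
  shows "energy A (complex_of_real c *s X) = c\<^sup>2 * energy A X"
  using self_adjoint_onD(3)[OF assms(1,2,2), of "complex_of_real c"]
  by (simp add: energy_def fock_inner_scale_left fock_inner_scale_right power2_eq_square mult_ac)

text \<open>Both sides are homogeneous of degree two, so the bound extends from the unit sphere.
  This allows variations of \<open>\<Phi>\<close> without renormalizing.\<close>

lemma minimizer_bound:
  assumes A: "self_adjoint_on N A" and m: "minimizer N A \<Phi>" and X: "X \<in> N_space N"
  shows "energy A \<Phi> * (norm X)\<^sup>2 \<le> energy A X"
proof (cases "X = 0")
  case True
  then show ?thesis by (simp add: energy_def fock_inner_def)
next
  case False
  from normalized_in_N_sphere[OF X False] m
  have "energy A \<Phi> \<le> energy A (complex_of_real (1 / norm X) *s X)"
    by (auto simp: minimizer_def)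
  also have "\<dots> = energy A X / (norm X)\<^sup>2"
    by (simp only: energy_scale[OF A X] power_divide) simp
  finally show ?thesis using False by (simp add: field_simps)
qed

lemma nonneg_quadratic_linear_coeff_zero:
  fixes a b :: real
  assumes "\<And>t. 0 \<le> 2 * t * a + t\<^sup>2 * b"
  shows "a = 0"
proof (rule ccontr)
  assume "a \<noteq> 0"
  \<comment> \<open>At \<open>t = - a / k\<close> the expression is
    \<open>(a / k)\<^sup>2 * (b - 2 * k)\<close>; \<open>k\<close> is chosen positive and with
    \<open>b < 2 * k\<close>.\<close>
  define k where "k = \<bar>b\<bar> + 1"
  have k: "k > 0" "b < 2 * k" by (auto simp: k_def)
  have "0 \<le> 2 * (- a / k) * a + (- a / k)\<^sup>2 * b" by (rule assms)
  also have "\<dots> = (a / k)\<^sup>2 * (b - 2 * k)"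
    using k(1) by (simp add: field_simps power2_eq_square)
  also have "\<dots> < 0" using \<open>a \<noteq> 0\<close> k by (intro mult_pos_neg) auto
  finally show False by simp
qed

text \<open>Vary \<open>\<Phi>\<close> in the direction of its own residual \<open>Y\<close>. The
  first-order change of the energy minus \<open>e\<close> times the squared norm is
  \<open>2 * t * (norm Y)\<^sup>2\<close>, which vanishes at a minimum.\<close>

lemma minimizer_eigenvector:
  assumes A: "self_adjoint_on N A" and m: "minimizer N A \<Phi>"
  shows "\<Phi> \<in> eigenspace N A (energy A \<Phi>)"
proof -
  define e where "e = energy A \<Phi>"
  from m have \<Phi>: "\<Phi> \<in> N_space N" "norm \<Phi> = 1" by (auto simp: minimizer_def N_sphere_def)
  define Y where "Y = A \<Phi> - complex_of_real e *s \<Phi>"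
  have Y: "Y \<in> N_space N"
    unfolding Y_def using self_adjoint_onD(1)[OF A \<Phi>(1) \<Phi>(1)] \<Phi>(1)
    by (intro N_space_diff N_space_scale)
  have YY: "(norm Y)\<^sup>2 = Re (fock_inner Y (A \<Phi>)) - e * Re (fock_inner Y \<Phi>)"
  proof -
    have "fock_inner Y Y + complex_of_real e * fock_inner Y \<Phi> = fock_inner Y (A \<Phi>)"
      using fock_inner_add_right[of Y Y "complex_of_real e *s \<Phi>"]
      by (simp add: fock_inner_scale_right Y_def)
    from arg_cong[OF this, of Re] show ?thesis by (simp add: fock_inner_self del: of_real_power)
  qed
  have "0 \<le> 2 * t * (norm Y)\<^sup>2 + t\<^sup>2 * (energy A Y - e * (norm Y)\<^sup>2)" for t
  proof -
    let ?tY = "complex_of_real t *s Y"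
    have tY: "?tY \<in> N_space N" by (rule N_space_scale[OF Y])
    have sw: "Re (fock_inner \<Phi> Y) = Re (fock_inner Y \<Phi>)" 
      using arg_cong[OF fock_inner_cnj[of \<Phi> Y], of Re] by simp
    have swA: "Re (fock_inner \<Phi> (A Y)) = Re (fock_inner Y (A \<Phi>))"
      using arg_cong[OF fock_inner_cnj[of Y "A \<Phi>"], of Re] self_adjoint_onD(4)[OF A \<Phi>(1) Y] by simp
    have "A (\<Phi> + ?tY) = A \<Phi> + complex_of_real t *s A Y"
      using self_adjoint_onD(2)[OF A \<Phi>(1) tY] self_adjoint_onD(3)[OF A Y Y] by simp
    then have 1: "energy A (\<Phi> + ?tY) = e + 2 * t * Re (fock_inner Y (A \<Phi>)) + t\<^sup>2 * energy A Y"
      by (simp add: energy_def e_def fock_inner_add_left fock_inner_add_right fock_inner_scale_left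
          fock_inner_scale_right swA power2_eq_square algebra_simps)
    have nrm: "(norm X)\<^sup>2 = Re (fock_inner X X)" for X :: "'a fock"
      by (simp add: fock_inner_self del: of_real_power)
    have 2: "(norm (\<Phi> + ?tY))\<^sup>2 = 1 + 2 * t * Re (fock_inner Y \<Phi>) + t\<^sup>2 * (norm Y)\<^sup>2"
      using nrm[of \<Phi>] unfolding nrm[of Y] nrm[of "\<Phi> + _"] \<Phi>(2)
      by (simp add: fock_inner_add_left fock_inner_add_right fock_inner_scale_left
          fock_inner_scale_right sw power2_eq_square algebra_simps)
    have "e * (norm (\<Phi> + ?tY))\<^sup>2 \<le> energy A (\<Phi> + ?tY)"
      unfolding e_def by (rule minimizer_bound[OF A m N_space_add[OF \<Phi>(1) tY]])
    then show ?thesis unfolding 1 2 YY by (simp add: algebra_simps)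
  qed
  then have "(norm Y)\<^sup>2 = 0" by (rule nonneg_quadratic_linear_coeff_zero)
  then have "Y = 0" by simp
  then show ?thesis using \<Phi>(1) by (simp add: eigenspace_def Y_def e_def)
qed

lemma minimizer_smallest_eigenvalue:
  assumes A: "self_adjoint_on N A" and m: "minimizer N A \<Phi>"
  shows "smallest_eigenvalue N A (energy A \<Phi>)"
proof -
  have "energy A \<Phi> \<le> E" if X: "X \<in> eigenspace N A E" "X \<noteq> 0" for X E
  proof -
    have "X \<in> N_space N" using X by (simp add: eigenspace_def)
    from minimizer_bound[OF A m this] energy_eigenvector[OF X(1)] X(2) show ?thesis by simp
  qed
  moreover have "\<Phi> \<noteq> 0" using m by (auto simp: minimizer_def N_sphere_def)
  ultimately show ?thesis
    using minimizer_eigenvector[OF A m] by (auto simp: smallest_eigenvalue_def is_eigenvalue_def)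
qed

lemma smallest_eigenvalue_unique:
  "smallest_eigenvalue N A E \<Longrightarrow> smallest_eigenvalue N A E' \<Longrightarrow> E = E'"
  unfolding smallest_eigenvalue_def by (simp add: order.antisym)

text \<open>A minimizer exists by compactness and its energy is the smallest eigenvalue. A
  normalized ground state has the same energy and therefore minimizes too.\<close>

lemma ground_state_iff_minimizer:
  fixes \<Phi> :: "('m::finite) fock"
  assumes A: "self_adjoint_on N A" and n: "norm \<Phi> = 1"
  shows "ground_state N A \<Phi> \<longleftrightarrow> minimizer N A \<Phi>"
proof
  assume "minimizer N A \<Phi>"
  then show "ground_state N A \<Phi>"
    using minimizer_smallest_eigenvalue[OF A] minimizer_eigenvector[OF A] n
    by (fastforce simp: ground_state_def)
next
  assume "ground_state N A \<Phi>"
  then obtain E where E: "smallest_eigenvalue N A E" "\<Phi> \<in> eigenspace N A E"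
    by (auto simp: ground_state_def)
  then have \<Phi>: "\<Phi> \<in> N_sphere N" using n by (simp add: eigenspace_def N_sphere_def)
  then obtain \<Psi> where \<Psi>: "minimizer N A \<Psi>" using minimizer_exists[OF A] by blast
  have "energy A \<Phi> = energy A \<Psi>"
    using smallest_eigenvalue_unique[OF E(1) minimizer_smallest_eigenvalue[OF A \<Psi>]]
      energy_eigenvector[OF E(2)] n by simp
  then show "minimizer N A \<Phi>" using \<Phi> \<Psi> by (simp add: minimizer_def)
qed

lemma eigenvectors_orthogonal:
  assumes A: "self_adjoint_on N A" and X: "X \<in> eigenspace N A E" and Y: "Y \<in> eigenspace N A E'"
    and "E \<noteq> E'"
  shows "fock_inner X Y = 0"
proof -
  have "fock_inner X (A Y) = fock_inner (A X) Y"
    using self_adjoint_onD(4)[OF A, of X Y] X Y by (auto simp: eigenspace_def)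
  then have "complex_of_real E' * fock_inner X Y = complex_of_real E * fock_inner X Y"
    using X Y by (simp add: eigenspace_def fock_inner_scale_left fock_inner_scale_right)
  then show ?thesis using \<open>E \<noteq> E'\<close> by simp
qed

text \<open>A nonzero vector is an independent set of size one, so dimension one means that it spans
  the eigenspace.\<close>

lemma simple_eigenvalue_iff:
  assumes A: "self_adjoint_on N A" and \<Phi>: "\<Phi> \<in> eigenspace N A E" "\<Phi> \<noteq> 0"
  shows "simple_eigenvalue N A E \<longleftrightarrow> (\<forall>X\<in>eigenspace N A E. \<exists>c. X = c *s \<Phi>)"
proof
  have ind: "vec.independent {\<Phi>}" using \<Phi>(2) by (simp add: vec.dependent_single)
  {
    assume "simple_eigenvalue N A E"
    then have "eigenspace N A E \<subseteq> vec.span {\<Phi>}"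
      using vec.card_ge_dim_independent[of "{\<Phi>}" "eigenspace N A E"] \<Phi>(1) ind
      by (simp add: simple_eigenvalue_def)
    then show "\<forall>X\<in>eigenspace N A E. \<exists>c. X = c *s \<Phi>" by (auto simp: vec.span_singleton)
  }
  assume "\<forall>X\<in>eigenspace N A E. \<exists>c. X = c *s \<Phi>"
  then have "eigenspace N A E = vec.span {\<Phi>}"
    using eigenspace_scale[OF A \<Phi>(1)] by (force simp: vec.span_singleton)
  then show "simple_eigenvalue N A E"
    using vec.dim_eq_card_independent[OF ind] by (simp add: simple_eigenvalue_def vec.dim_span)
qed

section \<open>Dependence on the potential\<close>

lemma potential_op_nth: "potential_op v \<Psi> $ I = complex_of_real (\<Sum>i\<in>I. v $ i) * \<Psi> $ I"
  by (simp add: potential_op_def sum_component number_operator sum.If_cases sum_distrib_right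
      if_distrib[of "(*) _"] cong: if_cong)

lemma hamiltonian_add: "hamiltonian H0 (v + u) \<Psi> = hamiltonian H0 v \<Psi> + potential_op u \<Psi>"
  by (simp add: hamiltonian_def vec_eq_iff potential_op_nth sum.distrib distrib_right)

lemma self_adjoint_hamiltonian:
  assumes H0: "self_adjoint_on N H0"
  shows "self_adjoint_on N (hamiltonian H0 v)"
proof -
  have V: "potential_op v X \<in> N_space N" if "X \<in> N_space N" for X
    using that by (auto simp: N_space_def potential_op_nth)
  have "potential_op v (X + Y) = potential_op v X + potential_op v Y"
    "potential_op v (c *s X) = c *s potential_op v X" for X Y c
    by (simp_all add: vec_eq_iff potential_op_nth distrib_left)
  moreover have "fock_inner X (potential_op v Y) = fock_inner (potential_op v X) Y" for X Y
    by (simp add: fock_inner_def potential_op_nth mult_ac)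
  ultimately show ?thesis
    using H0 V unfolding self_adjoint_on_def hamiltonian_def
    by (simp add: N_space_add fock_inner_add_left fock_inner_add_right vector_add_ldistrib)
qed

text \<open>Potentials are diagonal in the basis indexed by \<open>I\<close>, and exchanging the
  sums over \<open>i\<close> and \<open>I\<close> collects the density. The energy of a fixed state
  is thus affine in \<open>v\<close> with the density as slope.\<close>

lemma energy_hamiltonian: "energy (hamiltonian H0 v) \<Psi> = energy H0 \<Psi> + v \<bullet> density \<Psi>"
proof -
  have "cnj z * (complex_of_real a * z) = complex_of_real (a * (cmod z)\<^sup>2)" for z a
    by (simp add: complex_norm_square mult_ac del: of_real_power)
  then have "fock_inner \<Psi> (potential_op v \<Psi>) =
      complex_of_real (\<Sum>I\<in>UNIV. (\<Sum>i\<in>I. v $ i) * (cmod (\<Psi> $ I))\<^sup>2)"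
    by (simp add: fock_inner_def potential_op_nth del: of_real_sum of_real_mult of_real_power)
      (simp only: of_real_sum)
  then have "Re (fock_inner \<Psi> (potential_op v \<Psi>)) =
      (\<Sum>I\<in>UNIV. \<Sum>i\<in>UNIV. if i \<in> I then v $ i * (cmod (\<Psi> $ I))\<^sup>2 else 0)"
    by (simp add: sum.If_cases sum_distrib_right del: of_real_sum of_real_mult of_real_power)
  also have "\<dots> = v \<bullet> density \<Psi>"
    by (subst sum.swap) (simp add: inner_vec_def density_def sum.If_cases sum_distrib_left)
  finally show ?thesis
    by (simp add: energy_def hamiltonian_def fock_inner_add_right)
qed

section \<open>Compactness and continuity in the potential\<close>

lemma continuous_on_density [continuous_intros]:
  "continuous_on S f \<Longrightarrow> continuous_on S (\<lambda>x. density (f x))"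
  unfolding density_def by (intro continuous_intros)

lemma density_scale: "cmod c = 1 \<Longrightarrow> density (c *s \<Psi>) = density \<Psi>"
  by (simp add: density_def vec_eq_iff norm_mult)

lemma density_bounded:
  obtains K where "K > 0" "\<And>\<Phi> :: ('m::finite) fock. \<Phi> \<in> N_sphere N \<Longrightarrow> norm (density \<Phi>) \<le> K"
proof -
  have "compact (density ` (N_sphere N :: 'm fock set))"
    by (intro compact_continuous_image compact_N_sphere continuous_on_density continuous_on_id)
  then have "bounded (density ` (N_sphere N :: 'm fock set))" by (rule compact_imp_bounded)
  then show ?thesis using that unfolding bounded_pos by blast
qed

text \<open>The energy inequality against each fixed competitor \<open>X\<close> passes to the
  limit, and the unit sphere is closed.\<close>

lemma minimizer_limit:
  fixes H0 :: "('m::{finite,linorder}) fock \<Rightarrow> 'm fock"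
  assumes H0: "self_adjoint_on N H0"
    and min: "\<And>n. minimizer N (hamiltonian H0 (v n)) (\<Phi> n)"
    and v: "v \<longlonglongrightarrow> v'" and \<Phi>: "\<Phi> \<longlonglongrightarrow> \<Phi>'"
  shows "minimizer N (hamiltonian H0 v') \<Phi>'"
proof -
  have sph: "\<Phi> n \<in> N_sphere N" for n using min by (simp add: minimizer_def)
  have \<Phi>': "\<Phi>' \<in> N_sphere N"
    using closed_sequentially[OF compact_imp_closed[OF compact_N_sphere]] sph \<Phi> by blast
  have "(\<lambda>n. energy H0 (\<Phi> n)) \<longlonglongrightarrow> energy H0 \<Phi>'"
    by (rule continuous_on_tendsto_compose[OF continuous_on_energy[OF H0] \<Phi> \<Phi>']) (simp add: sph)
  moreover have "(\<lambda>n. density (\<Phi> n)) \<longlonglongrightarrow> density \<Phi>'"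
    by (rule continuous_on_tendsto_compose[OF continuous_on_density[OF continuous_on_id] \<Phi>, of UNIV]) auto
  ultimately have lim: "(\<lambda>n. energy (hamiltonian H0 (v n)) (\<Phi> n)) \<longlonglongrightarrow> energy (hamiltonian H0 v') \<Phi>'"
    unfolding energy_hamiltonian by (intro tendsto_intros v)
  have "energy (hamiltonian H0 v') \<Phi>' \<le> energy (hamiltonian H0 v') X" if X: "X \<in> N_sphere N" for X
  proof (rule LIMSEQ_le[OF lim])
    show "(\<lambda>n. energy (hamiltonian H0 (v n)) X) \<longlonglongrightarrow> energy (hamiltonian H0 v') X"
      unfolding energy_hamiltonian by (intro tendsto_intros v)
    show "\<exists>k. \<forall>n\<ge>k. energy (hamiltonian H0 (v n)) (\<Phi> n) \<le> energy (hamiltonian H0 (v n)) X"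
      using min X by (auto simp: minimizer_def)
  qed
  then show ?thesis using \<Phi>' by (simp add: minimizer_def)
qed

text \<open>The choice does not affect the value, since all minimizers have the same energy; if
  there is no minimizer, the value is unspecified.\<close>

definition ground_energy :: "nat \<Rightarrow> (('m::finite) fock \<Rightarrow> 'm fock) \<Rightarrow> real" where
  "ground_energy N A = energy A (SOME \<Psi>. minimizer N A \<Psi>)"

lemma ground_energy_eq: "minimizer N A \<Psi> \<Longrightarrow> ground_energy N A = energy A \<Psi>"
  unfolding ground_energy_def
  by (rule someI2[where P = "minimizer N A"]) (auto simp: minimizer_def intro: order.antisym)

text \<open>A minimizer at \<open>w\<close> is a trial state at \<open>v\<close>, which bounds the
  increase of the energy by \<open>K * norm (v - w)\<close>. Exchanging \<open>v\<close> and
  \<open>w\<close> gives a Lipschitz estimate.\<close>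

lemma continuous_on_ground_energy:
  fixes H0 :: "('m::{finite,linorder}) fock \<Rightarrow> 'm fock"
  assumes H0: "self_adjoint_on N H0" and ne: "N_sphere N \<noteq> ({} :: 'm fock set)"
  shows "continuous_on UNIV (\<lambda>v. ground_energy N (hamiltonian H0 v))"
proof -
  obtain K where K: "K > 0" "\<And>\<Phi> :: 'm fock. \<Phi> \<in> N_sphere N \<Longrightarrow> norm (density \<Phi>) \<le> K"
    using density_bounded by blast
  have le: "ground_energy N (hamiltonian H0 v) - ground_energy N (hamiltonian H0 w) \<le> K * norm (v - w)" for v w
  proof -
    obtain X where X: "minimizer N (hamiltonian H0 v) X"
      using minimizer_exists[OF self_adjoint_hamiltonian[OF H0] ne] by blast
    obtain Y where Y: "minimizer N (hamiltonian H0 w) Y"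
      using minimizer_exists[OF self_adjoint_hamiltonian[OF H0] ne] by blast
    have "energy (hamiltonian H0 v) X \<le> energy (hamiltonian H0 v) Y"
      using X Y by (simp add: minimizer_def)
    also have "\<dots> = energy (hamiltonian H0 w) Y + (v - w) \<bullet> density Y"
      by (simp add: energy_hamiltonian inner_diff_left)
    also have "(v - w) \<bullet> density Y \<le> norm (v - w) * norm (density Y)" by (rule norm_cauchy_schwarz)
    also have "\<dots> \<le> norm (v - w) * K" using K(2)[of Y] Y by (intro mult_left_mono) (auto simp: minimizer_def)
    finally show ?thesis by (simp add: ground_energy_eq[OF X] ground_energy_eq[OF Y] mult.commute)
  qed
  have "K-lipschitz_on UNIV (\<lambda>v. ground_energy N (hamiltonian H0 v))"
  proof (rule lipschitz_onI)
    fix v w :: "(real, 'm) vec"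
    show "dist (ground_energy N (hamiltonian H0 v)) (ground_energy N (hamiltonian H0 w)) \<le> K * dist v w"
      using le[of v w] le[of w v] by (simp add: dist_norm norm_minus_commute)
  qed (use K in auto)
  then show ?thesis by (rule lipschitz_on_continuous_on)
qed

text \<open>
  The unit vectors orthogonal to \<open>\<Psi>\<close> or vanishing somewhere on the support of \<open>\<Psi>\<close> form a compact
  set containing no ground state at \<open>v0\<close>, so their energies at \<open>v0\<close> are bounded away from the
  ground energy.
\<close>

lemma minimizers_stable:
  fixes H0 :: "('m::{finite,linorder}) fock \<Rightarrow> 'm fock"
  assumes H0: "self_adjoint_on N H0" and \<Psi>: "minimizer N (hamiltonian H0 v0) \<Psi>"
    and nondeg: "\<And>X. minimizer N (hamiltonian H0 v0) X \<Longrightarrow> \<exists>c. X = c *s \<Psi>"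
  obtains r where "r > 0"
    "\<And>v \<Phi>. norm (v - v0) \<le> r \<Longrightarrow> minimizer N (hamiltonian H0 v) \<Phi> \<Longrightarrow>
      fock_inner \<Psi> \<Phi> \<noteq> 0 \<and> (\<forall>I. \<Psi> $ I \<noteq> 0 \<longrightarrow> \<Phi> $ I \<noteq> 0)"
proof -
  let ?A = "hamiltonian H0 v0"
  define B where "B = N_sphere N \<inter>
    ({X. fock_inner \<Psi> X = 0} \<union> (\<Union>I\<in>{I. \<Psi> $ I \<noteq> 0}. {X. X $ I = 0}))"
  have "closed ({X. fock_inner \<Psi> X = 0} \<union> (\<Union>I\<in>{I. \<Psi> $ I \<noteq> 0}. {X. X $ I = 0}))"
    by (intro closed_Un closed_UN closed_Collect_eq continuous_intros ballI finite)
  then have B: "compact B" unfolding B_def by (rule compact_Int_closed[OF compact_N_sphere])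
  have cont: "continuous_on B (energy ?A)"
    by (rule continuous_on_subset[OF continuous_on_energy[OF self_adjoint_hamiltonian[OF H0]]])
      (auto simp: B_def)
  have norm\<Psi>: "norm \<Psi> = 1" "\<Psi> \<noteq> 0" using \<Psi> by (auto simp: minimizer_def N_sphere_def)
  have gt: "energy ?A \<Psi> < energy ?A X" if X: "X \<in> B" for X
  proof (rule ccontr)
    assume le: "\<not> energy ?A \<Psi> < energy ?A X"
    have "minimizer N ?A X" using le \<Psi> X unfolding minimizer_def B_def by force
    then obtain c where c: "X = c *s \<Psi>" using nondeg by blast
    have "X \<noteq> 0" using X by (auto simp: B_def N_sphere_def)
    then have "c \<noteq> 0" using c by auto
    then show False
      using X norm\<Psi> by (auto simp: c B_def fock_inner_scale_right fock_inner_self)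
  qed
  \<comment> \<open>If \<open>B\<close> is empty, any number above the ground energy serves as
    \<open>e\<close>.\<close>
  obtain e where e: "energy ?A \<Psi> < e" "\<And>X. X \<in> B \<Longrightarrow> e \<le> energy ?A X"
  proof (cases "B = {}")
    case True
    then show ?thesis using that[of "energy ?A \<Psi> + 1"] by simp
  next
    case False
    then obtain X where "X \<in> B" "\<And>Y. Y \<in> B \<Longrightarrow> energy ?A X \<le> energy ?A Y"
      using continuous_attains_inf[OF B _ cont] by blast
    then show ?thesis using that gt by blast
  qed
  obtain K where K: "K > 0" "\<And>\<Phi> :: 'm fock. \<Phi> \<in> N_sphere N \<Longrightarrow> norm (density \<Phi>) \<le> K"
    using density_bounded by blast
  \<comment> \<open>A change of potential of norm at most \<open>r\<close> moves each energy by at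
    most \<open>r * K\<close>, a third of the gap. Comparing \<open>\<Phi>\<close> with
    \<open>\<Psi>\<close> uses two such moves, which cannot close it.\<close>
  define r where "r = (e - energy ?A \<Psi>) / (3 * K)"
  have "r > 0" using K(1) e(1) by (simp add: r_def)
  moreover have "fock_inner \<Psi> \<Phi> \<noteq> 0 \<and> (\<forall>I. \<Psi> $ I \<noteq> 0 \<longrightarrow> \<Phi> $ I \<noteq> 0)"
    if v: "norm (v - v0) \<le> r" and \<Phi>: "minimizer N (hamiltonian H0 v) \<Phi>" for v \<Phi>
  proof (rule ccontr)
    assume bad: "\<not> ?thesis"
    have sph: "\<Phi> \<in> N_sphere N" "\<Psi> \<in> N_sphere N" using \<Phi> \<Psi> by (auto simp: minimizer_def)
    with bad have "\<Phi> \<in> B" by (auto simp: B_def)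
    then have "e \<le> energy ?A \<Phi>" by (rule e(2))
    have diff: "\<bar>energy (hamiltonian H0 v) X - energy ?A X\<bar> \<le> r * K" if "X \<in> N_sphere N" for X
    proof -
      have "\<bar>(v - v0) \<bullet> density X\<bar> \<le> norm (v - v0) * norm (density X)"
        by (rule Cauchy_Schwarz_ineq2)
      also have "\<dots> \<le> r * K" using v K(2)[OF that] \<open>r > 0\<close> by (intro mult_mono) auto
      finally show ?thesis by (simp add: energy_hamiltonian inner_diff_left)
    qed
    have "energy (hamiltonian H0 v) \<Phi> \<le> energy (hamiltonian H0 v) \<Psi>"
      using \<Phi> sph by (simp add: minimizer_def)
    then have "e \<le> energy ?A \<Psi> + 2 * (r * K)"
      using diff[OF sph(1)] diff[OF sph(2)] \<open>e \<le> energy ?A \<Phi>\<close> by linarith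
    moreover have "3 * (r * K) = e - energy ?A \<Psi>" using K(1) by (simp add: r_def)
    ultimately show False using e(1) by linarith
  qed
  ultimately show ?thesis using that by blast
qed

text \<open>From an eigenvector \<open>X\<close> subtract the multiple of \<open>\<Phi>\<close> that
  cancels the coefficient at \<open>I\<close>. A nonzero remainder, once normalized, would be a
  minimizer vanishing at \<open>I\<close>.\<close>

lemma eigenspace_one_dim:
  assumes A: "self_adjoint_on N A" and \<Phi>: "minimizer N A \<Phi>"
    and I: "\<And>X. minimizer N A X \<Longrightarrow> X $ I \<noteq> 0"
    and X: "X \<in> eigenspace N A (energy A \<Phi>)"
  shows "\<exists>c. X = c *s \<Phi>"
proof (rule exI, rule ccontr)
  let ?c = "X $ I / \<Phi> $ I"
  define Y where "Y = X - ?c *s \<Phi>"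
  assume "X \<noteq> ?c *s \<Phi>"
  then have "Y \<noteq> 0" by (simp add: Y_def)
  have Y: "Y \<in> eigenspace N A (energy A \<Phi>)"
    unfolding Y_def
    by (intro eigenspace_diff[OF A X] eigenspace_scale[OF A] minimizer_eigenvector[OF A \<Phi>])
  let ?Z = "complex_of_real (1 / norm Y) *s Y"
  have Z: "?Z \<in> eigenspace N A (energy A \<Phi>)" by (rule eigenspace_scale[OF A Y])
  have sph: "?Z \<in> N_sphere N"
    using Y \<open>Y \<noteq> 0\<close> by (intro normalized_in_N_sphere) (auto simp: eigenspace_def)
  then have "energy A ?Z = energy A \<Phi>"
    using energy_eigenvector[OF Z] by (simp add: N_sphere_def)
  then have "minimizer N A ?Z" using sph \<Phi> by (simp add: minimizer_def)
  from I[OF this] I[OF \<Phi>] show False by (simp add: Y_def)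
qed

section \<open>Unique representability\<close>

text \<open>Subtracting the two eigenvalue equations leaves the diagonal operator
  \<open>potential_op u\<close>, which can be read off coefficientwise.\<close>

lemma potential_constant_on_support:
  assumes "\<Phi> \<in> eigenspace N (hamiltonian H0 v) E" "\<Phi> \<in> eigenspace N (hamiltonian H0 (v + u)) E'"
    and "\<Phi> $ I \<noteq> 0"
  shows "(\<Sum>i\<in>I. u $ i) = E' - E"
proof -
  have "complex_of_real E' *s \<Phi> = complex_of_real E *s \<Phi> + potential_op u \<Phi>"
    using assms(1,2) hamiltonian_add[of H0 v u \<Phi>] by (simp add: eigenspace_def)
  then have "complex_of_real E' * \<Phi> $ I = (complex_of_real E + complex_of_real (\<Sum>i\<in>I. u $ i)) * \<Phi> $ I"
    by (metis (no_types) distrib_right potential_op_nth vector_add_component vector_smult_component)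
  then have "complex_of_real E' = complex_of_real (E + (\<Sum>i\<in>I. u $ i))" using assms(3) by simp
  then show ?thesis unfolding of_real_eq_iff by simp
qed

text \<open>A converse to \<open>potential_constant_on_support\<close>: \<open>\<Psi>\<close> is an
  eigenvector of \<open>potential_op u\<close>, hence it stays an eigenvector along the whole line,
  though not necessarily a ground state.\<close>

lemma eigenvector_shift:
  assumes "\<Psi> \<in> eigenspace N (hamiltonian H0 v) E"
    and "\<And>I. \<Psi> $ I \<noteq> 0 \<Longrightarrow> (\<Sum>i\<in>I. u $ i) = c"
  shows "\<Psi> \<in> eigenspace N (hamiltonian H0 (v + t *\<^sub>R u)) (E + t * c)"
proof -
  have "potential_op (t *\<^sub>R u) \<Psi> $ I = complex_of_real (t * c) * \<Psi> $ I" for I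
    using assms(2)[of I] by (cases "\<Psi> $ I = 0") (simp_all add: potential_op_nth flip: sum_distrib_left of_real_sum)
  then have "potential_op (t *\<^sub>R u) \<Psi> = complex_of_real (t * c) *s \<Psi>"
    by (simp add: vec_eq_iff)
  then show ?thesis
    using assms(1) by (simp add: eigenspace_def hamiltonian_add vector_sadd_rdistrib)
qed

lemma constant_vector_scale: "constant_vector u \<Longrightarrow> constant_vector (c *\<^sub>R u)"
  by (auto simp: constant_vector_def)

text \<open>Both parts of \<open>stable\<close> are used: the inclusion of supports carries the
  constancy of the sums of \<open>u\<close> from \<open>\<Phi>\<close> to \<open>\<Psi>\<close>, and
  non-orthogonality makes \<open>\<Psi>\<close> a ground state at the shifted potential.\<close>

lemma uv_state_stable:
  fixes H0 :: "('m::{finite,linorder}) fock \<Rightarrow> 'm fock"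
  assumes H0: "self_adjoint_on N H0" and uv: "uv_state N H0 v0 \<Psi>" and n: "norm \<Psi> = 1"
    and r: "r > 0"
    and stable: "\<And>v \<Phi>. norm (v - v0) \<le> r \<Longrightarrow> minimizer N (hamiltonian H0 v) \<Phi> \<Longrightarrow>
      fock_inner \<Psi> \<Phi> \<noteq> 0 \<and> (\<forall>I. \<Psi> $ I \<noteq> 0 \<longrightarrow> \<Phi> $ I \<noteq> 0)"
    and v: "norm (v - v0) \<le> r" and \<Phi>: "minimizer N (hamiltonian H0 v) \<Phi>"
  shows "uv_state N H0 v \<Phi>"
proof -
  note sa = self_adjoint_hamiltonian[OF H0]
  have n\<Phi>: "norm \<Phi> = 1" using \<Phi> by (auto simp: minimizer_def N_sphere_def)
  have \<Psi>: "minimizer N (hamiltonian H0 v0) \<Psi>"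
    using uv ground_state_iff_minimizer[OF sa n] by (simp add: uv_state_def)
  have "constant_vector (v - v')" if gs: "ground_state N (hamiltonian H0 v') \<Phi>" for v'
  proof (rule ccontr)
    assume nc: "\<not> constant_vector (v - v')"
    define u where "u = v' - v"
    define c where "c = energy (hamiltonian H0 v') \<Phi> - energy (hamiltonian H0 v) \<Phi>"
    have "minimizer N (hamiltonian H0 (v + u)) \<Phi>"
      using gs ground_state_iff_minimizer[OF sa n\<Phi>] by (simp add: u_def)
    then have ev: "\<Phi> \<in> eigenspace N (hamiltonian H0 (v + u)) (energy (hamiltonian H0 v') \<Phi>)"
      using minimizer_eigenvector[OF sa] by (fastforce simp: u_def)
    have "u \<noteq> 0" using nc by (auto simp: u_def constant_vector_def)
    \<comment> \<open>This puts \<open>v0 + t *\<^sub>R u\<close> at distance exactly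
      \<open>r\<close> from \<open>v0\<close>, still in the range of \<open>stable\<close>.\<close>
    define t where "t = r / norm u"
    have t: "t > 0" using r \<open>u \<noteq> 0\<close> by (simp add: t_def)
    have "(\<Sum>i\<in>I. u $ i) = c" if "\<Psi> $ I \<noteq> 0" for I
      unfolding c_def
      using potential_constant_on_support[OF minimizer_eigenvector[OF sa \<Phi>] ev] stable[OF v \<Phi>] that
      by blast
    then have ev\<Psi>: "\<Psi> \<in> eigenspace N (hamiltonian H0 (v0 + t *\<^sub>R u)) (energy (hamiltonian H0 v0) \<Psi> + t * c)"
      (is "_ \<in> eigenspace N ?A ?E") by (rule eigenvector_shift[OF minimizer_eigenvector[OF sa \<Psi>]])
    obtain X where X: "minimizer N ?A X"
      using minimizer_exists[OF sa] \<Phi> unfolding minimizer_def by blast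
    have "norm ((v0 + t *\<^sub>R u) - v0) \<le> r" using r \<open>u \<noteq> 0\<close> by (simp add: t_def)
    from stable[OF this X] have "fock_inner \<Psi> X \<noteq> 0" by simp
    \<comment> \<open>Eigenvectors for different eigenvalues would be orthogonal.\<close>
    then have "?E = energy ?A X"
      using eigenvectors_orthogonal[OF sa ev\<Psi> minimizer_eigenvector[OF sa X]] by blast
    moreover have "\<Psi> \<noteq> 0" using n by auto
    ultimately have "ground_state N ?A \<Psi>"
      using ev\<Psi> minimizer_smallest_eigenvalue[OF sa X] by (auto simp: ground_state_def)
    then have "constant_vector (v0 - (v0 + t *\<^sub>R u))" using uv unfolding uv_state_def by blast
    from constant_vector_scale[OF this, of "1 / t"] t nc show False
      by (simp add: u_def)
  qed
  then show ?thesis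
    using \<Phi> ground_state_iff_minimizer[OF sa n\<Phi>] by (auto simp: uv_state_def)
qed

text \<open>
  Danskin's argument, with compactness of the unit sphere in place of perturbation theory: ground
  states at \<open>v + t u\<close> converge along a subsequence to the ground state at \<open>v\<close> as \<open>t\<close> tends to 0.
\<close>

lemma density_at_maximum:
  fixes H0 :: "('m::{finite,linorder}) fock \<Rightarrow> 'm fock"
  assumes H0: "self_adjoint_on N H0" and \<Phi>: "minimizer N (hamiltonian H0 v) \<Phi>"
    and nondeg: "\<And>X. minimizer N (hamiltonian H0 v) X \<Longrightarrow> \<exists>c. X = c *s \<Phi>"
    and r: "r > 0"
    and max: "\<And>t. 0 < t \<Longrightarrow> t \<le> r \<Longrightarrow>
      ground_energy N (hamiltonian H0 (v + t *\<^sub>R u)) - (v + t *\<^sub>R u) \<bullet> \<rho>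
        \<le> ground_energy N (hamiltonian H0 v) - v \<bullet> \<rho>"
  shows "u \<bullet> (density \<Phi> - \<rho>) \<le> 0"
proof -
  note sa = self_adjoint_hamiltonian[OF H0]
  define t where "t n = r / real (Suc n)" for n
  have t: "0 < t n" "t n \<le> r" for n using r by (auto simp: t_def field_simps)
  have "t \<longlonglongrightarrow> 0"
    using LIMSEQ_Suc[OF lim_const_over_n[of r]] by (simp add: t_def[abs_def])
  have "\<exists>X. minimizer N (hamiltonian H0 (v + t n *\<^sub>R u)) X" for n
    using minimizer_exists[OF sa] \<Phi> by (auto simp: minimizer_def)
  then obtain X where X: "\<And>n. minimizer N (hamiltonian H0 (v + t n *\<^sub>R u)) (X n)" by metis
  have sph: "X n \<in> N_sphere N" for n using X by (auto simp: minimizer_def)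
  \<comment> \<open>\<open>X n\<close> attains the ground energy at the shifted potential and is a
    trial state at \<open>v\<close>. Combined with \<open>max\<close>, this leaves
    \<open>t n\<close> times the desired inner product.\<close>
  have le: "u \<bullet> (density (X n) - \<rho>) \<le> 0" for n
  proof -
    have "energy (hamiltonian H0 v) \<Phi> \<le> energy (hamiltonian H0 v) (X n)"
      using \<Phi> sph by (simp add: minimizer_def)
    then have "t n * (u \<bullet> (density (X n) - \<rho>)) \<le> 0"
      using max[OF t[of n]] unfolding ground_energy_eq[OF X] ground_energy_eq[OF \<Phi>]
      by (simp add: energy_hamiltonian inner_add_left inner_diff_right algebra_simps)
    then show ?thesis using t[of n] by (simp add: mult_le_0_iff)
  qed
  obtain L s where L: "L \<in> N_sphere N" and s: "strict_mono s" "(X \<circ> s) \<longlonglongrightarrow> L"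
    using compact_imp_seq_compact[OF compact_N_sphere] sph unfolding seq_compact_def by metis
  have lim_v: "(\<lambda>n. v + t (s n) *\<^sub>R u) \<longlonglongrightarrow> v"
    using LIMSEQ_subseq_LIMSEQ[OF \<open>t \<longlonglongrightarrow> 0\<close> s(1)] by (auto intro!: tendsto_eq_intros simp: o_def)
  have "minimizer N (hamiltonian H0 v) L"
    by (rule minimizer_limit[OF H0 _ lim_v s(2)]) (simp add: X)
  \<comment> \<open>The limit is a ground state at \<open>v\<close>, so it differs from
    \<open>\<Phi>\<close> by a phase, which the density does not see.\<close>
  then obtain c where c: "L = c *s \<Phi>" using nondeg by blast
  have "norm L = cmod c * norm \<Phi>"
    unfolding c by (simp add: norm_vec_def L2_set_def norm_mult power_mult_distrib real_sqrt_mult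
        flip: sum_distrib_left)
  then have "cmod c = 1" using L \<Phi> by (simp add: minimizer_def N_sphere_def)
  then have dens: "density L = density \<Phi>" unfolding c by (rule density_scale)
  have "(\<lambda>n. density ((X \<circ> s) n)) \<longlonglongrightarrow> density L"
    by (rule continuous_on_tendsto_compose[OF continuous_on_density[OF continuous_on_id] s(2), of UNIV]) auto
  then have "(\<lambda>n. u \<bullet> (density ((X \<circ> s) n) - \<rho>)) \<longlonglongrightarrow> u \<bullet> (density L - \<rho>)"
    by (intro tendsto_intros)
  from LIMSEQ_le_const2[OF this] le show ?thesis by (simp add: dens)
qed

text \<open>A norm is convex, hence continuous in finite dimension, and attains a positive minimum
  \<open>k\<close> on the Euclidean unit sphere; homogeneity does the rest. This places small
  \<open>nrm\<close>-balls inside Euclidean balls.\<close>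

lemma is_norm_dominates:
  fixes nrm :: "'a::euclidean_space \<Rightarrow> real"
  assumes "is_norm nrm"
  obtains k where "k > 0" "\<And>x. k * norm x \<le> nrm x"
proof -
  have zero: "nrm x = 0 \<longleftrightarrow> x = 0" and nonneg: "0 \<le> nrm x" and scale: "nrm (c *\<^sub>R x) = \<bar>c\<bar> * nrm x"
    and tri: "nrm (x + y) \<le> nrm x + nrm y" for x y c
    using assms unfolding is_norm_def by blast+
  have "convex_on UNIV nrm"
  proof (rule convex_onI)
    fix t x y assume "0 < t" "t < (1::real)"
    then show "nrm ((1 - t) *\<^sub>R x + t *\<^sub>R y) \<le> (1 - t) * nrm x + t * nrm y"
      using tri[of "(1 - t) *\<^sub>R x" "t *\<^sub>R y"] by (simp add: scale)
  qed simp
  then have "continuous_on (sphere 0 1) nrm"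
    using convex_on_continuous[OF open_UNIV] continuous_on_subset by blast
  moreover have "sphere (0::'a) 1 \<noteq> {}" by simp
  ultimately obtain x0 where x0: "x0 \<in> sphere 0 1" "\<And>y. y \<in> sphere 0 1 \<Longrightarrow> nrm x0 \<le> nrm y"
    using continuous_attains_inf[OF compact_sphere] by metis
  have "nrm x0 > 0" using x0(1) zero[of x0] nonneg[of x0] by (auto simp: less_le)
  moreover have "nrm x0 * norm x \<le> nrm x" for x
  proof (cases "x = 0")
    case False
    then have "nrm x0 \<le> nrm ((1 / norm x) *\<^sub>R x)" by (intro x0(2)) simp
    then show ?thesis using False by (simp add: scale field_simps)
  qed (simp add: nonneg)
  ultimately show ?thesis using that by blast
qed

text \<open>Vectors with sum zero form a complement of the constants and so represent potentials
  modulo constants.\<close>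

lemma constant_vector_sum_zero:
  assumes "constant_vector u" "(\<Sum>i\<in>UNIV. u $ i) = 0"
  shows "u = 0"
  using assms by (auto simp: constant_vector_def vec_eq_iff)

text \<open>\<open>\<Psi>\<close> as trial state at \<open>v0 + w\<close> gives the weak inequality.
  Equality would make \<open>\<Psi>\<close> a ground state there, although \<open>w\<close> is not
  constant.\<close>

lemma uv_strict_maximum:
  fixes H0 :: "('m::{finite,linorder}) fock \<Rightarrow> 'm fock"
  assumes H0: "self_adjoint_on N H0" and uv: "uv_state N H0 v0 \<Psi>" and n: "norm \<Psi> = 1"
    and w: "(\<Sum>i\<in>UNIV. w $ i) = 0" "w \<noteq> 0"
  shows "ground_energy N (hamiltonian H0 (v0 + w)) - w \<bullet> density \<Psi>
    < ground_energy N (hamiltonian H0 v0)"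
proof -
  note sa = self_adjoint_hamiltonian[OF H0]
  have \<Psi>: "minimizer N (hamiltonian H0 v0) \<Psi>"
    using uv ground_state_iff_minimizer[OF sa n] by (simp add: uv_state_def)
  let ?A = "hamiltonian H0 (v0 + w)"
  obtain X where X: "minimizer N ?A X"
    using minimizer_exists[OF sa] \<Psi> unfolding minimizer_def by blast
  have "energy ?A X < energy ?A \<Psi>"
  proof (rule ccontr)
    assume "\<not> ?thesis"
    then have "minimizer N ?A \<Psi>" using X \<Psi> unfolding minimizer_def by force
    then have "constant_vector (v0 - (v0 + w))"
      using uv ground_state_iff_minimizer[OF sa n] unfolding uv_state_def by blast
    from constant_vector_scale[OF this, of "- 1"] constant_vector_sum_zero[OF _ w(1)] w(2)
    show False by simp
  qed
  then show ?thesis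
    unfolding ground_energy_eq[OF X] ground_energy_eq[OF \<Psi>]
    by (simp add: energy_hamiltonian inner_add_left)
qed

section \<open>Perturbing the maximum\<close>

theorem theorem13:
  fixes N :: nat
    and H0 :: "('m::{finite,linorder}) fock \<Rightarrow> 'm fock"
    and nrm :: "real ^ ('m::{finite,linorder}) \<Rightarrow> real"
  assumes "1 \<le> N" and "N < CARD('m)"
    and "self_adjoint_on N H0"
    and "is_norm nrm"
  shows "\<forall>\<rho>\<in>uv_densities N H0. \<exists>\<epsilon>>0. \<forall>\<rho>'\<in>physical_densities N.
           nrm (\<rho>' - \<rho>) < \<epsilon> \<longrightarrow> \<rho>' \<in> uv_densities N H0"
proof
  fix \<rho> assume "\<rho> \<in> uv_densities N H0"
  then obtain v0 E \<Psi> where E: "smallest_eigenvalue N (hamiltonian H0 v0) E"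
    and simple: "simple_eigenvalue N (hamiltonian H0 v0) E"
    and ev: "\<Psi> \<in> eigenspace N (hamiltonian H0 v0) E" and n: "norm \<Psi> = 1"
    and \<rho>: "density \<Psi> = \<rho>" and uv: "uv_state N H0 v0 \<Psi>"
    unfolding uv_densities_def by blast
  note H0 = \<open>self_adjoint_on N H0\<close>
  note sa = self_adjoint_hamiltonian[OF H0]
  have \<Psi>: "minimizer N (hamiltonian H0 v0) \<Psi>"
    using uv ground_state_iff_minimizer[OF sa n] by (simp add: uv_state_def)
  have "\<Psi> \<noteq> 0" using n by auto
  \<comment> \<open>By \<open>stable\<close>, no ground state at a nearby potential vanishes at
    \<open>I0\<close>; this index is what \<open>eigenspace_one_dim\<close> needs.\<close>
  then obtain I0 where I0: "\<Psi> $ I0 \<noteq> 0" by (auto simp: vec_eq_iff)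
  have "\<exists>c. X = c *s \<Psi>" if X: "minimizer N (hamiltonian H0 v0) X" for X
  proof -
    have "energy (hamiltonian H0 v0) X = E"
      using smallest_eigenvalue_unique[OF minimizer_smallest_eigenvalue[OF sa X] E] .
    then show ?thesis
      using simple minimizer_eigenvector[OF sa X] 
      unfolding simple_eigenvalue_iff[OF sa ev \<open>\<Psi> \<noteq> 0\<close>] by auto
  qed
  then obtain r where r: "r > 0" and stable: "\<And>v \<Phi>. norm (v - v0) \<le> r \<Longrightarrow>
      minimizer N (hamiltonian H0 v) \<Phi> \<Longrightarrow>
      fock_inner \<Psi> \<Phi> \<noteq> 0 \<and> (\<forall>I. \<Psi> $ I \<noteq> 0 \<longrightarrow> \<Phi> $ I \<noteq> 0)"
    using minimizers_stable[OF H0 \<Psi>] by metis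

  define e where "e v = ground_energy N (hamiltonian H0 v)" for v
  define W where "W = {w :: (real, 'm) vec. (\<Sum>i\<in>UNIV. w $ i) = 0}"
  have "closed W" unfolding W_def by (intro closed_Collect_eq continuous_intros)
  have ne: "N_sphere N \<noteq> ({} :: 'm fock set)" using \<Psi> by (auto simp: minimizer_def)
  have cont_e: "continuous_on T (\<lambda>w. e (v0 + w))" for T
  proof -
    have "continuous_on UNIV e"
      using continuous_on_ground_energy[OF H0 ne] by (simp add: e_def[abs_def])
    then show ?thesis
      by (rule continuous_on_compose2[where f = "\<lambda>w. v0 + w"]) (auto intro: continuous_intros)
  qed
  \<comment> \<open>\<open>\<delta>\<close> is the least drop from the centre to the sphere of
    radius \<open>r\<close> in \<open>W\<close>, positive by strictness and compactness. On an empty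
    sphere the condition is vacuous and 1 is taken.\<close>
  obtain \<delta> where \<delta>: "\<delta> > 0" "\<And>w. w \<in> W \<Longrightarrow> norm w = r \<Longrightarrow> e (v0 + w) - w \<bullet> \<rho> \<le> e v0 - \<delta>"
  proof (cases "W \<inter> sphere 0 r = {}")
    case True
    then have none: "w \<in> W \<Longrightarrow> norm w = r \<Longrightarrow> False" for w by (auto simp: disjoint_iff)
    show ?thesis by (rule that[of 1]) (simp, use none in blast)
  next
    case False
    have "compact (W \<inter> sphere 0 r)" using \<open>closed W\<close> by (simp add: closed_Int_compact)
    moreover have "continuous_on (W \<inter> sphere 0 r) (\<lambda>w. e (v0 + w) - w \<bullet> \<rho>)"
      by (intro continuous_intros cont_e)
    ultimately obtain w0 where w0: "w0 \<in> W \<inter> sphere 0 r"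
      and sup: "\<And>w. w \<in> W \<inter> sphere 0 r \<Longrightarrow> e (v0 + w) - w \<bullet> \<rho> \<le> e (v0 + w0) - w0 \<bullet> \<rho>"
      using continuous_attains_sup[OF _ False] by blast
    have "e (v0 + w0) - w0 \<bullet> \<rho> < e v0"
      unfolding e_def \<rho>[symmetric] using w0 r
      by (intro uv_strict_maximum[OF H0 uv n]) (auto simp: W_def)
    then show ?thesis
      using that[of "e v0 - (e (v0 + w0) - w0 \<bullet> \<rho>)"] sup by auto
  qed

  have main: "\<rho>' \<in> uv_densities N H0"
    \<comment> \<open>For \<open>norm w = r\<close>, replacing \<open>\<rho>\<close> by
      \<open>\<rho>'\<close> changes \<open>w \<bullet> \<rho>\<close> by less than
      \<open>\<delta>\<close>, so the maximum over the ball stays in its interior.\<close>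
    if phys: "\<rho>' \<in> physical_densities N" and near: "norm (\<rho>' - \<rho>) < \<delta> / r" for \<rho>'
  proof -
    define g where "g w = e (v0 + w) - (v0 + w) \<bullet> \<rho>'" for w
    have "compact (W \<inter> cball 0 r)" using \<open>closed W\<close> by (simp add: closed_Int_compact)
    moreover have "0 \<in> W \<inter> cball 0 r" using r by (simp add: W_def)
    then have "W \<inter> cball 0 r \<noteq> {}" by blast
    moreover have "continuous_on (W \<inter> cball 0 r) g"
      unfolding g_def by (intro continuous_intros cont_e)
    ultimately obtain w where w: "w \<in> W \<inter> cball 0 r"
      and sup: "\<And>x. x \<in> W \<inter> cball 0 r \<Longrightarrow> g x \<le> g w"
      using continuous_attains_sup[of "W \<inter> cball 0 r" g] by blast
    have "norm w < r"
    proof (rule ccontr)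
      assume "\<not> norm w < r"
      with w have "norm w = r" "w \<in> W" by auto
      then have "g w \<le> g 0 - \<delta> - w \<bullet> (\<rho>' - \<rho>)"
        using \<delta>(2)[of w] by (simp add: g_def inner_add_left inner_diff_right)
      moreover have "\<bar>w \<bullet> (\<rho>' - \<rho>)\<bar> \<le> r * norm (\<rho>' - \<rho>)"
        using Cauchy_Schwarz_ineq2[of w "\<rho>' - \<rho>"] \<open>norm w = r\<close> by simp
      moreover have "r * norm (\<rho>' - \<rho>) < \<delta>" using near r by (simp add: field_simps)
      moreover have "g 0 \<le> g w" using r by (intro sup) (simp add: W_def)
      ultimately show False by linarith
    qed
    define v where "v = v0 + w"
    have v: "norm (v - v0) \<le> r" using \<open>norm w < r\<close> by (simp add: v_def)
    obtain \<Phi> where \<Phi>: "minimizer N (hamiltonian H0 v) \<Phi>" using minimizer_exists[OF sa ne] by blast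
    then have \<Phi>': "\<Phi> \<in> N_space N" "norm \<Phi> = 1" by (auto simp: minimizer_def N_sphere_def)
    have ev\<Phi>: "\<Phi> \<in> eigenspace N (hamiltonian H0 v) (energy (hamiltonian H0 v) \<Phi>)"
      by (rule minimizer_eigenvector[OF sa \<Phi>])
    have one_dim: "\<exists>c. X = c *s \<Phi>"
      if "X \<in> eigenspace N (hamiltonian H0 v) (energy (hamiltonian H0 v) \<Phi>)" for X
      using eigenspace_one_dim[OF sa \<Phi> _ that] stable[OF v] I0 by blast
    have nondeg: "\<exists>c. X = c *s \<Phi>" if X: "minimizer N (hamiltonian H0 v) X" for X
      using one_dim minimizer_eigenvector[OF sa X] ground_energy_eq[OF X] ground_energy_eq[OF \<Phi>]
      by simp
    \<comment> \<open>The density error itself is the test direction. Both densities sum to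
      \<open>N\<close>, so it lies in \<open>W\<close>, and maximality within \<open>W\<close> will
      give \<open>u \<bullet> u \<le> 0\<close>.\<close>
    define u where "u = density \<Phi> - \<rho>'"
    have "u \<in> W"
      using phys density_physical[OF \<Phi>'] by (simp add: u_def W_def physical_densities_def sum_subtractf)
    \<comment> \<open>Steps of length at most \<open>s\<close> along \<open>u\<close> stay in the
      ball of radius \<open>r\<close>; the added 1 avoids division by zero when
      \<open>u = 0\<close>.\<close>
    define s where "s = (r - norm w) / (1 + norm u)"
    have pos: "1 + norm u > 0" using norm_ge_zero[of u] by linarith
    have "s > 0" using \<open>norm w < r\<close> pos by (simp add: s_def)
    have "u \<bullet> (density \<Phi> - \<rho>') \<le> 0"
    proof (rule density_at_maximum[OF H0 \<Phi> nondeg \<open>s > 0\<close>])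
      fix t assume t: "0 < t" "t \<le> s"
      have "norm (w + t *\<^sub>R u) \<le> norm w + t * norm u"
        using norm_triangle_ineq[of w "t *\<^sub>R u"] t by simp
      also have "t * norm u \<le> s * (1 + norm u)" using t by (intro mult_mono) auto
      also have "\<dots> = r - norm w" using pos by (simp add: s_def)
      finally have "norm (w + t *\<^sub>R u) \<le> r" by simp
      moreover have "w + t *\<^sub>R u \<in> W"
        using w \<open>u \<in> W\<close> by (simp add: W_def sum.distrib flip: sum_distrib_left)
      ultimately have "g (w + t *\<^sub>R u) \<le> g w" by (intro sup) simp
      then show "ground_energy N (hamiltonian H0 (v + t *\<^sub>R u)) - (v + t *\<^sub>R u) \<bullet> \<rho>'
          \<le> ground_energy N (hamiltonian H0 v) - v \<bullet> \<rho>'"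
        by (simp add: g_def e_def v_def add.assoc)
    qed
    then have "u = 0" unfolding u_def[symmetric] by (metis inner_gt_zero_iff not_less)
    then have "density \<Phi> = \<rho>'" by (simp add: u_def)
    moreover have "simple_eigenvalue N (hamiltonian H0 v) (energy (hamiltonian H0 v) \<Phi>)"
      using one_dim \<Phi>'(2) simple_eigenvalue_iff[OF sa ev\<Phi>] by fastforce
    moreover have "uv_state N H0 v \<Phi>" by (rule uv_state_stable[OF H0 uv n r stable v \<Phi>])
    ultimately show ?thesis
      unfolding uv_densities_def
      using minimizer_smallest_eigenvalue[OF sa \<Phi>] ev\<Phi> \<Phi>'(2) by blast
  qed

  obtain k where k: "k > 0" "\<And>x. k * norm x \<le> nrm x"
    using is_norm_dominates[OF \<open>is_norm nrm\<close>] by blast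
  show "\<exists>\<epsilon>>0. \<forall>\<rho>'\<in>physical_densities N. nrm (\<rho>' - \<rho>) < \<epsilon> \<longrightarrow> \<rho>' \<in> uv_densities N H0"
  proof (intro exI[of _ "k * (\<delta> / r)"] conjI ballI impI)
    show "k * (\<delta> / r) > 0" using k \<delta> r by simp
    fix \<rho>' assume "\<rho>' \<in> physical_densities N" "nrm (\<rho>' - \<rho>) < k * (\<delta> / r)"
    moreover from this(2) k(2)[of "\<rho>' - \<rho>"] have "k * norm (\<rho>' - \<rho>) < k * (\<delta> / r)" by linarith
    then have "norm (\<rho>' - \<rho>) < \<delta> / r" using k(1) by (simp only: mult_less_cancel_left_pos)
    ultimately show "\<rho>' \<in> uv_densities N H0" using main by blast
  qed
qed

end
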